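(* Let $\Omega$ be a finite set, let $m: 2^\Omega \to [0,1]$ be a basic belief assignment, and let $X:\Omega\to\mathbb{R}$ be a function with expectation $\mathrm{Exp}(X)=\sum_{C \subseteq \Omega} m(C)\min_{\omega\in C}X(\omega)$ with respect to $m$. For each $n\ge 1$ let $\mathrm{Bel}_n: 2^{\Omega^n}\to[0,1]$ be the belief function of the $n$-fold product basic belief assignment $m_n$ on $\Omega^n$, and for $1\le j\le n$ let $X_j:\Omega^n\to\mathbb{R}$ be given by $X_j((\omega_1,\dots,\omega_n)) = X(\omega_j)$. Then for every $\epsilon>0$ we have $$\lim_{n \to \infty} \mathrm{Bel}_n \left( \frac{1}{n} \sum_{j=1}^n X_j \geq \mathrm{Exp}(X) - \epsilon \right) = 1$$ and $$\lim_{n \to \infty} \mathrm{Bel}_n \left( \frac{1}{n} \sum_{j=1}^n X_j \geq \mathrm{Exp}(X) + \epsilon \right) = 0.$$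
   Context: For a finite set $\Omega$, a basic belief assignment is a function $m: 2^\Omega\to[0,1]$ with $m(\emptyset)=0$ and $\sum_{C\subseteq\Omega} m(C)=1$. Its corresponding belief function is $\mathrm{Bel}(A)=\sum_{C\subseteq A} m(C)$ for $A\subseteq\Omega$. The $n$-fold product basic belief assignment $m_n: 2^{\Omega^n}\to[0,1]$ is given by $m_n(A_1\times\cdots\times A_n)=\prod_{j=1}^n m(A_j)$ for nonempty $A_1,\dots,A_n\subseteq\Omega$, and $m_n(C)=0$ for every $C\subseteq\Omega^n$ that is not of the form $A_1\times\cdots\times A_n$ with all $A_j$ nonempty. Then $\mathrm{Bel}_n(D)=\sum_{C\subseteq D}m_n(C)$ for $D\subseteq\Omega^n$. In the definition of $\mathrm{Exp}(X)$ the term for $C=\emptyset$ is taken to be $0$ (as $m(\emptyset)=0$). For a function $f:\Omega^n\to\mathbb{R}$ and $\alpha\in\mathbb{R}$, $\mathrm{Bel}_n(f\ge\alpha)$ means $\mathrm{Bel}_n(\{\omega\in\Omega^n : f(\omega)\ge\alpha\})$. *)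

theory Defs
  imports "HOL-Analysis.Analysis"
begin

text \<open>The frame is a finite set \<open>\<Omega>\<close>; mass functions are total functions on
  \<^typ>\<open>'a set\<close> of which only the values on \<open>Pow \<Omega>\<close> are relevant.\<close>

definition basic_belief_assignment :: "'a set \<Rightarrow> ('a set \<Rightarrow> real) \<Rightarrow> bool" where
  "basic_belief_assignment \<Omega> m \<longleftrightarrow>
     (\<forall>C\<in>Pow \<Omega>. m C \<in> {0..1}) \<and> m {} = 0 \<and> (\<Sum>C\<in>Pow \<Omega>. m C) = 1"

definition Bel :: "('a set \<Rightarrow> real) \<Rightarrow> 'a set \<Rightarrow> real" where
  "Bel m A = (\<Sum>C\<in>Pow A. m C)"

text \<open>The empty set is left out of the sum: its term is \<open>0\<close> by convention, and
  \<open>Min {}\<close> is unspecified.\<close>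

definition Exp :: "'a set \<Rightarrow> ('a set \<Rightarrow> real) \<Rightarrow> ('a \<Rightarrow> real) \<Rightarrow> real" where
  "Exp \<Omega> m X = (\<Sum>C\<in>Pow \<Omega> - {{}}. m C * Min (X ` C))"

text \<open>Points of \<open>\<Omega>\<^sup>n\<close> are extensional functions on the index set \<open>{1..n}\<close>.\<close>

definition cart_power :: "'a set \<Rightarrow> nat \<Rightarrow> (nat \<Rightarrow> 'a) set" where
  "cart_power \<Omega> n = PiE {1..n} (\<lambda>_. \<Omega>)"

text \<open>If \<open>C\<close> is a product of nonempty sets \<open>A j\<close>, then \<open>A j\<close> is the \<open>j\<close>-th projection of
  \<open>C\<close>; this makes \<open>m\<^sub>n\<close> well defined. The lemmas \<open>product_bba_PiE\<close> and
  \<open>product_bba_not_PiE\<close> are the two usual defining clauses.\<close>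

definition product_bba ::
    "'a set \<Rightarrow> ('a set \<Rightarrow> real) \<Rightarrow> nat \<Rightarrow> (nat \<Rightarrow> 'a) set \<Rightarrow> real" where
  "product_bba \<Omega> m n C =
     (if \<exists>A. (\<forall>j\<in>{1..n}. A j \<subseteq> \<Omega> \<and> A j \<noteq> {}) \<and> C = PiE {1..n} A
      then \<Prod>j\<in>{1..n}. m ((\<lambda>\<omega>. \<omega> j) ` C)
      else 0)"

lemma product_bba_PiE:
  assumes "\<And>j. j \<in> {1..n} \<Longrightarrow> A j \<subseteq> \<Omega>" "\<And>j. j \<in> {1..n} \<Longrightarrow> A j \<noteq> {}"
  shows "product_bba \<Omega> m n (PiE {1..n} A) = (\<Prod>j\<in>{1..n}. m (A j))"
proof -
  have "PiE {1..n} A \<noteq> {}"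
    using assms(2) by (simp add: PiE_eq_empty_iff)
  then have "(\<lambda>\<omega>. \<omega> j) ` PiE {1..n} A = A j" if "j \<in> {1..n}" for j
    using that by (simp add: image_projection_PiE)
  moreover have "\<exists>B. (\<forall>j\<in>{1..n}. B j \<subseteq> \<Omega> \<and> B j \<noteq> {}) \<and> PiE {1..n} A = PiE {1..n} B"
    using assms by blast
  ultimately show ?thesis
    unfolding product_bba_def by (subst if_P) (auto intro: prod.cong)
qed

lemma product_bba_not_PiE:
  assumes "\<nexists>A. (\<forall>j\<in>{1..n}. A j \<subseteq> \<Omega> \<and> A j \<noteq> {}) \<and> C = PiE {1..n} A"
  shows "product_bba \<Omega> m n C = 0"
  using assms unfolding product_bba_def by (rule if_not_P)

lemma basic_belief_assignment_product_bba:
  assumes fin: "finite \<Omega>" and m: "basic_belief_assignment \<Omega> m"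
  shows "basic_belief_assignment (cart_power \<Omega> n) (product_bba \<Omega> m n)"
proof -
  define P where "P = PiE {1..n} (\<lambda>_. Pow \<Omega> - {{}})"
  have P: "A j \<subseteq> \<Omega>" "A j \<noteq> {}" if "A \<in> P" "j \<in> {1..n}" for A j
    using that unfolding P_def by (auto dest!: PiE_mem)
  have finite_Om: "finite (cart_power \<Omega> n)"
    using fin by (simp add: cart_power_def finite_PiE)
  have m01: "0 \<le> m C" "m C \<le> 1" if "C \<subseteq> \<Omega>" for C
    using m that unfolding basic_belief_assignment_def by auto
  have m1: "(\<Sum>C\<in>Pow \<Omega> - {{}}. m C) = 1"
    using m fin unfolding basic_belief_assignment_def by (simp add: sum_diff1)
  have sub: "PiE {1..n} ` P \<subseteq> Pow (cart_power \<Omega> n)"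
    using P(1) PiE_mono[of "{1..n}" _ "\<lambda>_. \<Omega>"] unfolding cart_power_def by blast
  have char: "C \<in> PiE {1..n} ` P"
    if C: "\<forall>j\<in>{1..n}. A j \<subseteq> \<Omega> \<and> A j \<noteq> {}" "C = PiE {1..n} A" for C A
  proof (rule image_eqI)
    show "C = PiE {1..n} (restrict A {1..n})"
      unfolding C(2) by (rule PiE_cong) simp
    show "restrict A {1..n} \<in> P"
      using C(1) unfolding P_def by auto
  qed
  have zero: "product_bba \<Omega> m n C = 0" if "C \<notin> PiE {1..n} ` P" for C
    using that char by (intro product_bba_not_PiE) blast
  have prodm: "product_bba \<Omega> m n (PiE {1..n} A) = (\<Prod>j\<in>{1..n}. m (A j))" if "A \<in> P" for A
    using P that by (intro product_bba_PiE) auto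
  have inj: "inj_on (PiE {1..n}) P"
  proof (rule inj_onI)
    fix A B assume AB: "A \<in> P" "B \<in> P" "PiE {1..n} A = PiE {1..n} B"
    have "\<forall>j\<in>{1..n}. A j = B j"
      using AB P by (subst (asm) PiE_eq_iff_not_empty) auto
    then show "A = B"
      using AB(1,2) unfolding P_def by (intro PiE_ext) auto
  qed
  have "(\<Sum>C\<in>Pow (cart_power \<Omega> n). product_bba \<Omega> m n C)
      = (\<Sum>C\<in>PiE {1..n} ` P. product_bba \<Omega> m n C)"
    using sub zero finite_Om by (intro sum.mono_neutral_right) auto
  also have "\<dots> = (\<Sum>A\<in>P. \<Prod>j\<in>{1..n}. m (A j))"
    unfolding sum.reindex[OF inj] by (intro sum.cong) (simp_all only: o_apply prodm)
  also have "\<dots> = (\<Prod>j\<in>{1..n}. \<Sum>C\<in>Pow \<Omega> - {{}}. m C)"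
    unfolding P_def using fin by (subst prod_sum_PiE) auto
  also have "\<dots> = 1" by (simp add: m1)
  finally have total: "(\<Sum>C\<in>Pow (cart_power \<Omega> n). product_bba \<Omega> m n C) = 1" .
  have bounds: "product_bba \<Omega> m n C \<in> {0..1}" for C
  proof (cases "C \<in> PiE {1..n} ` P")
    case True
    then obtain A where A: "A \<in> P" "C = PiE {1..n} A" by blast
    have "0 \<le> m (A j) \<and> m (A j) \<le> 1" if "j \<in> {1..n}" for j
      using m01 P(1)[OF A(1) that] by blast
    then have "0 \<le> (\<Prod>j\<in>{1..n}. m (A j))" "(\<Prod>j\<in>{1..n}. m (A j)) \<le> 1"
      by (auto intro!: prod_nonneg prod_le_1)
    then show ?thesis
      unfolding A(2) prodm[OF A(1)] by simp
  qed (simp add: zero)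
  have "PiE {1..n} A \<noteq> {}" if "A \<in> P" for A
    using P(2)[OF that] by (simp add: PiE_eq_empty_iff)
  then have "product_bba \<Omega> m n {} = 0"
    by (intro zero) blast
  then show ?thesis
    using total bounds unfolding basic_belief_assignment_def by blast
qed

end

theory Submission
  imports Defs
begin

text \<open>A box \<open>A\<^sub>1 \<times> \<dots> \<times> A\<^sub>n\<close> lies in the event that the average of the \<open>X\<^sub>j\<close> is at least
  \<open>t\<close> iff the average of the minima \<open>min X(A\<^sub>j)\<close> is at least \<open>t\<close>. So \<open>Bel\<^sub>n\<close> of this event is the
  probability, for independent random focal sets \<open>A\<^sub>j\<close> distributed according to \<open>m\<close>, that the
  average of the random variables \<open>min X(A\<^sub>j)\<close>, whose mean is \<open>Exp(X)\<close>, is at least \<open>t\<close>. Both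
  limits are then the weak law of large numbers, by Chebyshev's inequality.\<close>

text \<open>The weight \<open>\<Prod>k\<in>I. p (A k)\<close> makes the coordinates independent. As
  \<open>Y\<close> has mean \<open>0\<close> under \<open>p\<close>, distinct coordinates are
  uncorrelated; the diagonal case gives the variance.\<close>

lemma sum_PiE_prod_mult_two:
  fixes p Y :: "'b \<Rightarrow> real"
  assumes fin: "finite I" "finite S" and i: "i \<in> I" and j: "j \<in> I"
    and p1: "(\<Sum>s\<in>S. p s) = 1" and Y0: "(\<Sum>s\<in>S. p s * Y s) = 0"
  shows "(\<Sum>A\<in>PiE I (\<lambda>_. S). (\<Prod>k\<in>I. p (A k)) * (Y (A i) * Y (A j)))
       = (if i = j then \<Sum>s\<in>S. p s * (Y s)\<^sup>2 else 0)"
proof -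
  \<comment> \<open>Moving \<open>Y (A i)\<close> and \<open>Y (A j)\<close> into the factors of
    coordinates \<open>i\<close> and \<open>j\<close> turns the summand into a product over
    \<open>I\<close>, so the sum over \<open>PiE\<close> factorises. For \<open>i = j\<close> one
    factor receives both.\<close>
  define g where
    "g k s = p s * ((if k = i then Y s else 1) * (if k = j then Y s else 1))" for k s
  have "(\<Prod>k\<in>I. p (A k)) * (Y (A i) * Y (A j)) = (\<Prod>k\<in>I. g k (A k))" for A
    using i j fin(1) unfolding g_def prod.distrib by simp
  then have "(\<Sum>A\<in>PiE I (\<lambda>_. S). (\<Prod>k\<in>I. p (A k)) * (Y (A i) * Y (A j)))
      = (\<Prod>k\<in>I. \<Sum>s\<in>S. g k s)"
    using fin by (simp add: prod_sum_PiE)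
  also have "\<dots> = (if i = j then \<Sum>s\<in>S. p s * (Y s)\<^sup>2 else 0)"
  proof (cases "i = j")
    case True
    have "(\<Sum>s\<in>S. g k s) = (if k = i then \<Sum>s\<in>S. p s * (Y s)\<^sup>2 else 1)" for k
      using True p1 by (simp add: g_def power2_eq_square)
    then show ?thesis
      using True i fin(1) by simp
  next
    case False
    then have "(\<Sum>s\<in>S. g i s) = 0"
      using Y0 by (simp add: g_def)
    then show ?thesis
      using False i fin(1) by (auto simp: prod_zero_iff)
  qed
  finally show ?thesis .
qed

text \<open>Additivity of variance: after expanding the square, only the diagonal terms survive, one
  for each element of \<open>I\<close>.\<close>

lemma sum_PiE_prod_variance:
  fixes p Y :: "'b \<Rightarrow> real"
  assumes fin: "finite I" "finite S"
    and p1: "(\<Sum>s\<in>S. p s) = 1" and Y0: "(\<Sum>s\<in>S. p s * Y s) = 0"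
  shows "(\<Sum>A\<in>PiE I (\<lambda>_. S). (\<Prod>k\<in>I. p (A k)) * (\<Sum>j\<in>I. Y (A j))\<^sup>2)
       = real (card I) * (\<Sum>s\<in>S. p s * (Y s)\<^sup>2)"
proof -
  have "(\<Sum>A\<in>PiE I (\<lambda>_. S). (\<Prod>k\<in>I. p (A k)) * (\<Sum>j\<in>I. Y (A j))\<^sup>2)
      = (\<Sum>A\<in>PiE I (\<lambda>_. S). \<Sum>i\<in>I. \<Sum>j\<in>I. (\<Prod>k\<in>I. p (A k)) * (Y (A i) * Y (A j)))"
    unfolding power2_eq_square sum_product by (simp only: sum_distrib_left)
  also have "\<dots> =
      (\<Sum>i\<in>I. \<Sum>j\<in>I. \<Sum>A\<in>PiE I (\<lambda>_. S). (\<Prod>k\<in>I. p (A k)) * (Y (A i) * Y (A j)))"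
    by (subst sum.swap, intro sum.cong refl, subst sum.swap) simp
  also have "\<dots> = (\<Sum>i\<in>I. \<Sum>j\<in>I. if i = j then \<Sum>s\<in>S. p s * (Y s)\<^sup>2 else 0)"
    by (intro sum.cong refl sum_PiE_prod_mult_two fin p1 Y0)
  also have "\<dots> = real (card I) * (\<Sum>s\<in>S. p s * (Y s)\<^sup>2)"
    using fin(1) by simp
  finally show ?thesis .
qed

lemma sum_PiE_prod_chebyshev:
  fixes p Y :: "'b \<Rightarrow> real"
  assumes fin: "finite I" "finite S" and p0: "\<And>s. s \<in> S \<Longrightarrow> 0 \<le> p s"
    and p1: "(\<Sum>s\<in>S. p s) = 1" and Y0: "(\<Sum>s\<in>S. p s * Y s) = 0" and t: "t > 0"
  shows "(\<Sum>A | A \<in> PiE I (\<lambda>_. S) \<and> t \<le> \<bar>\<Sum>j\<in>I. Y (A j)\<bar>. \<Prod>k\<in>I. p (A k))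
       \<le> real (card I) * (\<Sum>s\<in>S. p s * (Y s)\<^sup>2) / t\<^sup>2"
proof -
  let ?P = "PiE I (\<lambda>_. S)"
  let ?Q = "{A \<in> ?P. t \<le> \<bar>\<Sum>j\<in>I. Y (A j)\<bar>}"
  let ?w = "\<lambda>A. \<Prod>k\<in>I. p (A k)"
  have w0: "0 \<le> ?w A" if "A \<in> ?P" for A
    using that p0 by (intro prod_nonneg) auto
  have finP: "finite ?P"
    using fin by (simp add: finite_PiE)
  have "t\<^sup>2 * (\<Sum>A\<in>?Q. ?w A) = (\<Sum>A\<in>?Q. ?w A * t\<^sup>2)"
    by (simp add: sum_distrib_left mult.commute)
  also have "\<dots> \<le> (\<Sum>A\<in>?Q. ?w A * (\<Sum>j\<in>I. Y (A j))\<^sup>2)"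
    \<comment> \<open>On \<open>?Q\<close> the squared sum is at least \<open>t\<^sup>2\<close>;
      this is Markov's inequality for the square.\<close>
    using w0 t by (intro sum_mono mult_left_mono) (auto simp flip: abs_le_square_iff)
  also have "\<dots> \<le> (\<Sum>A\<in>?P. ?w A * (\<Sum>j\<in>I. Y (A j))\<^sup>2)"
    using w0 finP by (intro sum_mono2) auto
  also have "\<dots> = real (card I) * (\<Sum>s\<in>S. p s * (Y s)\<^sup>2)"
    by (rule sum_PiE_prod_variance[OF fin p1 Y0])
  finally show ?thesis
    using t by (simp add: field_simps)
qed

text \<open>Only boxes with nonempty sides can carry mass, and such a box determines its sides.
  Hence the sum over subsets of \<open>D\<close> can be reindexed by families of sides.\<close>

lemma Bel_product_bba:
  assumes fin: "finite \<Omega>" and D: "D \<subseteq> cart_power \<Omega> n"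
  shows "Bel (product_bba \<Omega> m n) D =
    (\<Sum>A | A \<in> PiE {1..n} (\<lambda>_. Pow \<Omega> - {{}}) \<and> PiE {1..n} A \<subseteq> D. \<Prod>j\<in>{1..n}. m (A j))"
proof -
  let ?P = "PiE {1..n} (\<lambda>_. Pow \<Omega> - {{}})"
  let ?Q = "{A \<in> ?P. PiE {1..n} A \<subseteq> D}"
  have P: "A j \<subseteq> \<Omega>" "A j \<noteq> {}" if "A \<in> ?P" "j \<in> {1..n}" for A j
    using that by (auto dest!: PiE_mem)
  have finD: "finite D"
    using fin D by (auto simp: cart_power_def finite_PiE intro: finite_subset)
  have inj: "inj_on (PiE {1..n}) ?Q"
  proof (rule inj_onI)
    fix A B assume AB: "A \<in> ?Q" "B \<in> ?Q" "PiE {1..n} A = PiE {1..n} B"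
    have "\<forall>j\<in>{1..n}. A j = B j"
      using AB P by (subst (asm) PiE_eq_iff_not_empty) auto
    then show "A = B"
      using AB(1,2) PiE_ext[of A "{1..n}" "\<lambda>_. Pow \<Omega> - {{}}" B] by blast
  qed
  have zero: "product_bba \<Omega> m n C = 0" if C: "C \<in> Pow D - PiE {1..n} ` ?Q" for C
  proof (rule product_bba_not_PiE, safe)
    fix A assume A: "\<forall>j\<in>{1..n}. A j \<subseteq> \<Omega> \<and> A j \<noteq> {}" "C = PiE {1..n} A"
    \<comment> \<open>Restricting \<open>A\<close> leaves the box unchanged and makes the family
      extensional, as membership in \<open>?Q\<close> demands.\<close>
    have "C = PiE {1..n} (restrict A {1..n})"
      unfolding A(2) by (rule PiE_cong) simp
    moreover from this have "restrict A {1..n} \<in> ?Q"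
      using A(1) C by auto
    ultimately show False
      using C by blast
  qed
  have "Bel (product_bba \<Omega> m n) D = (\<Sum>C\<in>PiE {1..n} ` ?Q. product_bba \<Omega> m n C)"
    unfolding Bel_def using finD zero by (intro sum.mono_neutral_right) auto
  also have "\<dots> = (\<Sum>A\<in>?Q. \<Prod>j\<in>{1..n}. m (A j))"
    unfolding sum.reindex[OF inj] o_def
    using P by (intro sum.cong refl product_bba_PiE) blast+
  finally show ?thesis .
qed

text \<open>A sum of functions of separate coordinates is minimised over a box coordinate by
  coordinate; a point made of minimisers \<open>a j\<close> attains the sum of the minima.\<close>

lemma sum_ge_on_PiE_iff:
  fixes X :: "'a \<Rightarrow> real"
  assumes "\<And>j. j \<in> I \<Longrightarrow> finite (A j)" "\<And>j. j \<in> I \<Longrightarrow> A j \<noteq> {}"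
  shows "(\<forall>\<omega>\<in>PiE I A. c \<le> (\<Sum>j\<in>I. X (\<omega> j))) \<longleftrightarrow> c \<le> (\<Sum>j\<in>I. Min (X ` A j))"
proof
  assume L: "\<forall>\<omega>\<in>PiE I A. c \<le> (\<Sum>j\<in>I. X (\<omega> j))"
  have "\<exists>a. a \<in> A j \<and> X a = Min (X ` A j)" if "j \<in> I" for j
    using Min_in[of "X ` A j"] assms that by fastforce
  then obtain a where a: "\<And>j. j \<in> I \<Longrightarrow> a j \<in> A j \<and> X (a j) = Min (X ` A j)"
    by metis
  then have "restrict a I \<in> PiE I A"
    by auto
  then have "c \<le> (\<Sum>j\<in>I. X (restrict a I j))"
    using L by blast
  also have "\<dots> = (\<Sum>j\<in>I. Min (X ` A j))"
    using a by (intro sum.cong) auto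
  finally show "c \<le> (\<Sum>j\<in>I. Min (X ` A j))" .
next
  assume R: "c \<le> (\<Sum>j\<in>I. Min (X ` A j))"
  show "\<forall>\<omega>\<in>PiE I A. c \<le> (\<Sum>j\<in>I. X (\<omega> j))"
  proof
    fix \<omega> assume "\<omega> \<in> PiE I A"
    then have "(\<Sum>j\<in>I. Min (X ` A j)) \<le> (\<Sum>j\<in>I. X (\<omega> j))"
      using assms by (intro sum_mono Min_le) auto
    with R show "c \<le> (\<Sum>j\<in>I. X (\<omega> j))"
      by simp
  qed
qed

lemma Bel_average_ge:
  fixes X :: "'a \<Rightarrow> real"
  assumes fin: "finite \<Omega>" and n: "n > 0"
  shows "Bel (product_bba \<Omega> m n)
      {\<omega> \<in> cart_power \<Omega> n. (1 / real n) * (\<Sum>j=1..n. X (\<omega> j)) \<ge> t} =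
    (\<Sum>A | A \<in> PiE {1..n} (\<lambda>_. Pow \<Omega> - {{}}) \<and> real n * t \<le> (\<Sum>j=1..n. Min (X ` A j)).
       \<Prod>j\<in>{1..n}. m (A j))"
proof -
  let ?D = "{\<omega> \<in> cart_power \<Omega> n. (1 / real n) * (\<Sum>j=1..n. X (\<omega> j)) \<ge> t}"
  have "PiE {1..n} A \<subseteq> ?D \<longleftrightarrow> real n * t \<le> (\<Sum>j=1..n. Min (X ` A j))"
    if A: "A \<in> PiE {1..n} (\<lambda>_. Pow \<Omega> - {{}})" for A
  proof -
    have Aj: "A j \<subseteq> \<Omega>" "A j \<noteq> {}" if "j \<in> {1..n}" for j
      using A that by (auto dest!: PiE_mem)
    have "PiE {1..n} A \<subseteq> cart_power \<Omega> n"
      unfolding cart_power_def using Aj by (intro PiE_mono)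
    then have "PiE {1..n} A \<subseteq> ?D \<longleftrightarrow>
        (\<forall>\<omega>\<in>PiE {1..n} A. t \<le> (1 / real n) * (\<Sum>j=1..n. X (\<omega> j)))"
      by blast
    \<comment> \<open>Here \<open>n > 0\<close> matters: since \<open>1 / 0 = 0\<close>, for
      \<open>n = 0\<close> the left side would say \<open>t \<le> 0\<close>, while the right side
      would always hold.\<close>
    also have "\<dots> \<longleftrightarrow> (\<forall>\<omega>\<in>PiE {1..n} A. real n * t \<le> (\<Sum>j=1..n. X (\<omega> j)))"
      using n by (simp add: field_simps)
    also have "\<dots> \<longleftrightarrow> real n * t \<le> (\<Sum>j=1..n. Min (X ` A j))"
      using Aj fin by (intro sum_ge_on_PiE_iff) (auto intro: finite_subset)
    finally show ?thesis .
  qed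
  then show ?thesis
    using fin by (subst Bel_product_bba) (auto intro!: sum.cong)
qed

theorem theorem8p2:
  fixes \<Omega> :: "'a set" and m :: "'a set \<Rightarrow> real" and X :: "'a \<Rightarrow> real" and \<epsilon> :: real
  assumes "finite \<Omega>"
    and "basic_belief_assignment \<Omega> m"
    and "\<epsilon> > 0"
  shows "(\<lambda>n. Bel (product_bba \<Omega> m n)
            {\<omega> \<in> cart_power \<Omega> n. (1 / real n) * (\<Sum>j=1..n. X (\<omega> j)) \<ge> Exp \<Omega> m X - \<epsilon>})
           \<longlonglongrightarrow> 1
       \<and> (\<lambda>n. Bel (product_bba \<Omega> m n)
            {\<omega> \<in> cart_power \<Omega> n. (1 / real n) * (\<Sum>j=1..n. X (\<omega> j)) \<ge> Exp \<Omega> m X + \<epsilon>})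
           \<longlonglongrightarrow> 0"
proof -
  define S where "S = Pow \<Omega> - {{}}"
  define P where "P n = PiE {1..n} (\<lambda>_. S)" for n :: nat
  define w where "w n A = (\<Prod>j\<in>{1..n}. m (A j))" for n :: nat and A
  define \<mu> where "\<mu> = Exp \<Omega> m X"
  \<comment> \<open>Centering the minima at \<open>\<mu>\<close> gives the mean-zero variable that
    the Chebyshev bound requires; \<open>V\<close> is its variance.\<close>
  define Y where "Y C = Min (X ` C) - \<mu>" for C
  define V where "V = (\<Sum>C\<in>S. m C * (Y C)\<^sup>2)"
  define b where "b n t = Bel (product_bba \<Omega> m n)
      {\<omega> \<in> cart_power \<Omega> n. (1 / real n) * (\<Sum>j=1..n. X (\<omega> j)) \<ge> t}" for n t
  have finS: "finite S"
    using assms(1) by (simp add: S_def)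
  have finP: "finite (P n)" for n
    using finS by (simp add: P_def finite_PiE)
  have m0: "0 \<le> m C" if "C \<in> S" for C
    using assms(2) that unfolding basic_belief_assignment_def S_def by auto
  have m1: "(\<Sum>C\<in>S. m C) = 1"
    using assms(1,2) unfolding basic_belief_assignment_def S_def by (simp add: sum_diff1)
  have Y0: "(\<Sum>C\<in>S. m C * Y C) = 0"
    unfolding Y_def right_diff_distrib sum_subtractf
    by (simp add: m1 \<mu>_def Exp_def S_def flip: sum_distrib_right)
       (use m1 in \<open>simp add: S_def\<close>)
  have w0: "0 \<le> w n A" if "A \<in> P n" for n A
    using that unfolding P_def w_def by (intro prod_nonneg) (auto dest: PiE_mem intro!: m0)
  have w1: "(\<Sum>A\<in>P n. w n A) = 1" for n
    unfolding P_def w_def using finS prod_sum_PiE[of "{1..n}" "\<lambda>_. S" "\<lambda>_. m"] by (simp add: m1)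
  have b_eq: "b n (\<mu> + s) = (\<Sum>A | A \<in> P n \<and> real n * s \<le> (\<Sum>j=1..n. Y (A j)). w n A)"
    if "n > 0" for n s
    unfolding b_def Bel_average_ge[OF assms(1) that] P_def S_def w_def Y_def
    by (simp add: sum_subtractf algebra_simps)
  \<comment> \<open>Chebyshev with threshold \<open>real n * \<epsilon>\<close>: the variance
    \<open>n * V\<close> of the sum is divided by \<open>(n * \<epsilon>)\<^sup>2\<close>.\<close>
  have tail: "(\<Sum>A | A \<in> P n \<and> real n * \<epsilon> \<le> \<bar>\<Sum>j=1..n. Y (A j)\<bar>. w n A) \<le> V / \<epsilon>\<^sup>2 / real n"
    if "n > 0" for n
    using sum_PiE_prod_chebyshev[of "{1..n}" S m Y "real n * \<epsilon>", OF _ finS m0 m1 Y0] that assms(3)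
    unfolding P_def w_def V_def by (simp add: power2_eq_square field_simps)
  \<comment> \<open>The one-sided event is contained in the two-sided deviation event of
    \<open>tail\<close>.\<close>
  have upper: "b n (\<mu> + \<epsilon>) \<le> V / \<epsilon>\<^sup>2 / real n" if "n > 0" for n
    unfolding b_eq[OF that] using w0 finP
    by (intro order_trans[OF sum_mono2 tail[OF that]]) auto
  have nonneg: "0 \<le> b n (\<mu> + s)" if "n > 0" for n s
    unfolding b_eq[OF that] using w0 by (intro sum_nonneg) auto
  have le1: "b n (\<mu> + s) \<le> 1" if "n > 0" for n s
    unfolding b_eq[OF that] w1[of n, symmetric] using w0 finP by (intro sum_mono2) auto
  \<comment> \<open>Outside \<open>?G\<close> the sum of the \<open>Y (A j)\<close> is below
    \<open>- n * \<epsilon>\<close>, so the complement also lies in the event of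
    \<open>tail\<close>. Writing \<open>\<mu> + - \<epsilon>\<close> lets \<open>b_eq\<close> apply
    with \<open>s = - \<epsilon>\<close>.\<close>
  have lower: "1 - V / \<epsilon>\<^sup>2 / real n \<le> b n (\<mu> + - \<epsilon>)" if "n > 0" for n
  proof -
    let ?G = "{A \<in> P n. real n * - \<epsilon> \<le> (\<Sum>j=1..n. Y (A j))}"
    have "1 - b n (\<mu> + - \<epsilon>) = (\<Sum>A\<in>P n - ?G. w n A)"
      unfolding b_eq[OF that] w1[of n, symmetric] using finP by (subst sum_diff) auto
    also have "\<dots> \<le> V / \<epsilon>\<^sup>2 / real n"
      using w0 finP by (intro order_trans[OF sum_mono2 tail[OF that]]) auto
    finally show ?thesis by simp
  qed
  have lim: "(\<lambda>n. V / \<epsilon>\<^sup>2 / real n) \<longlonglongrightarrow> 0"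
    by (rule lim_const_over_n)
  have "(\<lambda>n. 1 - V / \<epsilon>\<^sup>2 / real n) \<longlonglongrightarrow> 1"
    using tendsto_diff[OF tendsto_const lim, of 1] by simp
  \<comment> \<open>The bounds are available for \<open>n > 0\<close>, hence eventually, which
    suffices for squeezing.\<close>
  then have "(\<lambda>n. b n (\<mu> + - \<epsilon>)) \<longlonglongrightarrow> 1"
    by (rule tendsto_sandwich[rotated 2, OF _ tendsto_const])
       (use lower le1[where s = "- \<epsilon>"] in \<open>auto intro: eventually_mono[OF eventually_gt_at_top[of 0]]\<close>)
  moreover have "(\<lambda>n. b n (\<mu> + \<epsilon>)) \<longlonglongrightarrow> 0"
    by (rule tendsto_sandwich[rotated 2, OF tendsto_const lim])
       (use upper nonneg in \<open>auto intro: eventually_mono[OF eventually_gt_at_top[of 0]]\<close>)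
  ultimately show ?thesis
    by (simp add: b_def \<mu>_def)
qed

end
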